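(* Let $X\subseteq\mathbb{Z}^2\setminus\{O\}$ be an arbitrary finite step set, and let $\mathcal{C}$ be a submonoid of $\mathbb{Z}^2$. Suppose also that there is an (open) cone $K\subseteq\mathbb{R}^2$ with vertex $O$ such that $K\cap\mathbb{Z}^2\subseteq\mathcal{C}$ and $K\cap\mathcal{A}_X^{\mathcal{C}}\neq\varnothing$. Then the following are equivalent: (i) $(X,\mathcal{C})$ has the Finite Paths Property (FPP); (ii) $O\notin\operatorname{Conv}(X)$; (iii) $X$ satisfies the Line Condition (LC).
   Context: Write $O=(0,0)$. A step set is any subset $X$ of $\mathbb{Z}^2\setminus\{O\}$. $\mathcal{F}_X$ is the free monoid on $X$ (all finite words over $X$, including the empty word), with $\ell(w)$ the length of $w$; for $w=A_1\cdots A_k\in\mathcal{F}_X$ put $\alpha_X(w)=A_1+\cdots+A_k$ and, for $0\le m\le k$, $\sigma_m(w)=A_1\cdots A_m$. For a submonoid $\mathcal{C}$ of $\mathbb{Z}^2$, define $\mathcal{F}_X^{\mathcal{C}}=\{w\in\mathcal{F}_X:\alpha_X(\sigma_m(w))\in\mathcal{C}\text{ for all }0\le m\le\ell(w)\}$ and $\mathcal{A}_X^{\mathcal{C}}=\alpha_X(\mathcal{F}_X^{\mathcal{C}})$. For $A\in\mathbb{Z}^2$, $\pi_X^{\mathcal{C}}(A)$ is the (possibly infinite) number of $w\in\mathcal{F}_X^{\mathcal{C}}$ with $\alpha_X(w)=A$. $(X,\mathcal{C})$ has the FPP if $\pi_X^{\mathcal{C}}(A)<\infty$ for all $A\in\mathcal{A}_X^{\mathcal{C}}$.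 A cone is an intersection of two open half-planes of $\mathbb{R}^2$ whose bounding lines are not parallel; its vertex is the intersection point of these lines. $X$ satisfies the LC if it is contained in an open half-plane of $\mathbb{R}^2$ bounded by a line through $O$. $\operatorname{Conv}$ denotes convex hull in $\mathbb{R}^2$. *)

theory Defs
  imports "HOL-Analysis.Analysis"
begin

definition emb :: "int \<times> int \<Rightarrow> real \<times> real" where
  "emb A = (real_of_int (fst A), real_of_int (snd A))"

definition step_set :: "(int \<times> int) set \<Rightarrow> bool" where
  "step_set X \<longleftrightarrow> X \<subseteq> UNIV - {(0, 0)}"

definition is_submonoid :: "(int \<times> int) set \<Rightarrow> bool" where
  "is_submonoid C \<longleftrightarrow> (0, 0) \<in> C \<and> (\<forall>A\<in>C. \<forall>B\<in>C. A + B \<in> C)"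

text \<open>Words over \<open>X\<close> are the elements of \<open>lists X\<close>; the sum of the letters of \<open>w\<close> is
  \<open>sum_list w\<close>, and its prefix of length \<open>m\<close> is \<open>take m w\<close>.\<close>

definition constrained_words :: "(int \<times> int) set \<Rightarrow> (int \<times> int) set \<Rightarrow> (int \<times> int) list set" where
  "constrained_words X C = {w \<in> lists X. \<forall>m\<le>length w. sum_list (take m w) \<in> C}"

definition reachable :: "(int \<times> int) set \<Rightarrow> (int \<times> int) set \<Rightarrow> (int \<times> int) set" where
  "reachable X C = sum_list ` constrained_words X C"

definition words_to :: "(int \<times> int) set \<Rightarrow> (int \<times> int) set \<Rightarrow> int \<times> int \<Rightarrow> (int \<times> int) list set" where
  "words_to X C A = {w \<in> constrained_words X C. sum_list w = A}"

definition num_paths :: "(int \<times> int) set \<Rightarrow> (int \<times> int) set \<Rightarrow> int \<times> int \<Rightarrow> enat" where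
  "num_paths X C A = (if finite (words_to X C A) then enat (card (words_to X C A)) else \<infinity>)"

definition FPP :: "(int \<times> int) set \<Rightarrow> (int \<times> int) set \<Rightarrow> bool" where
  "FPP X C \<longleftrightarrow> (\<forall>A\<in>reachable X C. num_paths X C A < \<infinity>)"

text \<open>For \<open>a \<noteq> 0\<close>, these are a line with normal vector \<open>a\<close> and an open half-plane bounded by it;
  the other side is obtained from \<open>- a\<close> and \<open>- c\<close>.\<close>

definition bounding_line :: "real \<times> real \<Rightarrow> real \<Rightarrow> (real \<times> real) set" where
  "bounding_line a c = {x. a \<bullet> x = c}"

definition open_half_plane :: "real \<times> real \<Rightarrow> real \<Rightarrow> (real \<times> real) set" where
  "open_half_plane a c = {x. a \<bullet> x > c}"

text \<open>Two lines with nonzero normal vectors \<open>a\<close> and \<open>b\<close> are parallel (possibly equal) iff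
  \<open>a\<close> is a scalar multiple of \<open>b\<close>.\<close>

definition cone_with_vertex :: "(real \<times> real) set \<Rightarrow> real \<times> real \<Rightarrow> bool" where
  "cone_with_vertex K v \<longleftrightarrow>
    (\<exists>a c b d. a \<noteq> 0 \<and> b \<noteq> 0 \<and> (\<nexists>t. a = t *\<^sub>R b) \<and>
      K = open_half_plane a c \<inter> open_half_plane b d \<and>
      bounding_line a c \<inter> bounding_line b d = {v})"

definition LC :: "(int \<times> int) set \<Rightarrow> bool" where
  "LC X \<longleftrightarrow> (\<exists>a c. a \<noteq> 0 \<and> (0, 0) \<in> bounding_line a c \<and> emb ` X \<subseteq> open_half_plane a c)"

end

theory Submission
  imports Defs
begin

text \<open>The point that needs an argument is that FPP fails when \<open>O\<close> is in the convex hull of \<open>X\<close>.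
  A real convex relation \<open>\<Sum>x. u x * x = 0\<close> yields one with natural coefficients: the sums
  \<open>\<Sum>x. \<lfloor>n * u x\<rfloor> * x\<close> are bounded integer vectors, so two of them agree for some \<open>n < m\<close> far apart,
  and the differences of the floors are the coefficients. Hence some nonempty word \<open>v\<close> over \<open>X\<close> has
  sum \<open>O\<close>. If \<open>w\<close> is an admissible word ending in \<open>K\<close>, then for large \<open>n\<close> the endpoint of \<open>w^n\<close> lies so
  deep in \<open>K\<close> that the loop \<open>v\<close> can be traversed there without leaving \<open>K\<close>, so all the words
  \<open>w^n v^k\<close> are admissible and have the same endpoint.\<close>

section \<open>The embedding into the plane and sums of words\<close>

lemma emb_zero [simp]: "emb 0 = 0" and emb_add: "emb (A + B) = emb A + emb B"
  by (simp_all add: emb_def zero_prod_def)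

lemma inj_emb: "inj emb"
  by (auto simp: inj_on_def emb_def prod_eq_iff)

lemma sum_list_concat_replicate_zero:
  fixes v :: "'a::monoid_add list"
  assumes "sum_list v = 0"
  shows "sum_list (concat (replicate n v)) = 0"
  using assms by (induction n) simp_all

lemma emb_sum_list_concat_replicate:
  "emb (sum_list (concat (replicate n w))) = real n *\<^sub>R emb (sum_list w)"
  by (induction n) (simp_all add: emb_add algebra_simps)

text \<open>This is the passage from coefficients to words: concatenate blocks of \<open>k x\<close>
  copies of each letter. The length clause later certifies that a word is nonempty.\<close>

lemma exists_word_with_multiplicities:
  fixes k :: "int \<times> int \<Rightarrow> nat"
  assumes "finite X"
  shows "\<exists>w\<in>lists X. emb (sum_list w) = (\<Sum>x\<in>X. real (k x) *\<^sub>R emb x) \<and> length w = (\<Sum>x\<in>X. k x)"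
  using assms
proof (induction X)
  case empty
  show ?case by simp
next
  case (insert x X)
  then obtain w where "w \<in> lists X" "emb (sum_list w) = (\<Sum>x\<in>X. real (k x) *\<^sub>R emb x)"
    "length w = (\<Sum>x\<in>X. k x)" by blast
  moreover have "emb (sum_list (replicate n x)) = real n *\<^sub>R emb x" for n
    by (induction n) (simp_all add: emb_add algebra_simps)
  moreover have "replicate (k x) x @ w \<in> lists (insert x X)"
    using \<open>w \<in> lists X\<close> by (auto simp: in_lists_conv_set)
  ultimately show ?case
    using insert.hyps by (intro bexI[of _ "replicate (k x) x @ w"]) (simp_all add: emb_add)
qed

lemma finite_emb_bounded: "finite {A. norm (emb A) \<le> R}"
proof (rule finite_subset)
  show "{A. norm (emb A) \<le> R} \<subseteq> {-\<lceil>R\<rceil>..\<lceil>R\<rceil>} \<times> {-\<lceil>R\<rceil>..\<lceil>R\<rceil>}"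
  proof
    fix A assume A: "A \<in> {A. norm (emb A) \<le> R}"
    have "\<bar>real_of_int (fst A)\<bar> \<le> R" "\<bar>real_of_int (snd A)\<bar> \<le> R"
      using A norm_fst_le[of "fst (emb A)" "snd (emb A)"] norm_snd_le[of "snd (emb A)" "fst (emb A)"]
      by (simp_all add: emb_def)
    then show "A \<in> {-\<lceil>R\<rceil>..\<lceil>R\<rceil>} \<times> {-\<lceil>R\<rceil>..\<lceil>R\<rceil>}"
      by (cases A) (simp, linarith)
  qed
qed simp

section \<open>Zero-sum words from real convex relations\<close>

lemma exists_zero_sum_word:
  assumes fin: "finite X" and hull: "0 \<in> convex hull (emb ` X)"
  shows "\<exists>v\<in>lists X. v \<noteq> [] \<and> sum_list v = 0"
proof -
  have "\<exists>u'. (\<forall>y\<in>emb ` X. 0 \<le> u' y) \<and> sum u' (emb ` X) = 1 \<and> (\<Sum>y\<in>emb ` X. u' y *\<^sub>R y) = 0"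
    using hull fin by (simp add: convex_hull_finite)
  then obtain u' where u': "\<forall>y\<in>emb ` X. 0 \<le> u' y" "sum u' (emb ` X) = 1"
    "(\<Sum>y\<in>emb ` X. u' y *\<^sub>R y) = 0" by blast
  define u where "u = u' \<circ> emb"
  have inj: "inj_on emb X"
    using inj_emb by (rule inj_on_subset) simp
  have u0: "0 \<le> u x" if "x \<in> X" for x
    using u'(1) that by (simp add: u_def)
  have u1: "sum u X = 1"
    using u'(2) by (simp add: sum.reindex[OF inj] u_def)
  have us: "(\<Sum>x\<in>X. u x *\<^sub>R emb x) = 0"
    using u'(3) by (simp add: sum.reindex[OF inj] u_def)
  obtain z where z: "z \<in> X" "u z > 0"
    using u1 u0 by (metis less_eq_real_def sum.neutral zero_neq_one)
  \<comment> \<open>Spacing by \<open>N\<close> raises the real coefficient of \<open>z\<close> by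
    at least 1, so its floor strictly increases along multiples of \<open>N\<close>. This keeps the
    final word from being empty.\<close>
  obtain N :: nat where N: "real N * u z \<ge> 1"
    using reals_Archimedean3[OF z(2)] by (meson less_imp_le)
  have "N > 0"
    using N by (cases N) auto
  define f where "f n x = nat \<lfloor>real n * u x\<rfloor>" for n x
  define R where "R = (\<Sum>x\<in>X. norm (emb x))"
  have f_real: "real (f n x) = of_int \<lfloor>real n * u x\<rfloor>" if "x \<in> X" for n x
    using u0[OF that] by (simp add: f_def)
  have bound: "norm (\<Sum>x\<in>X. real (f n x) *\<^sub>R emb x) \<le> R" for n
  proof -
    \<comment> \<open>Subtracting \<open>n\<close> times the zero relation leaves only rounding
      errors as coefficients, so the bound does not depend on \<open>n\<close>.\<close>
    have "(\<Sum>x\<in>X. real (f n x) *\<^sub>R emb x)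
        = (\<Sum>x\<in>X. real (f n x) *\<^sub>R emb x) - real n *\<^sub>R (\<Sum>x\<in>X. u x *\<^sub>R emb x)"
      by (simp add: us)
    also have "\<dots> = (\<Sum>x\<in>X. (real (f n x) - real n * u x) *\<^sub>R emb x)"
      by (simp add: scaleR_sum_right sum_subtractf scaleR_diff_left)
    also have "norm \<dots> \<le> R"
      unfolding R_def
    proof (rule sum_norm_le)
      fix x assume "x \<in> X"
      have "\<bar>real (f n x) - real n * u x\<bar> \<le> 1"
        unfolding f_real[OF \<open>x \<in> X\<close>] by linarith
      then show "norm ((real (f n x) - real n * u x) *\<^sub>R emb x) \<le> norm (emb x)"
        by (simp add: mult_left_le_one_le)
    qed
    finally show ?thesis .
  qed
  define g where "g j = (\<Sum>x\<in>X. real (f (j * N) x) *\<^sub>R emb x)" for j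
  have "range g \<subseteq> emb ` {A. norm (emb A) \<le> R}"
  proof
    fix y assume "y \<in> range g"
    then obtain j where j: "y = g j" by blast
    \<comment> \<open>Being the sum of a word shows that \<open>g j\<close> is an integer
      point.\<close>
    obtain w where "emb (sum_list w) = g j"
      using exists_word_with_multiplicities[OF fin, of "f (j * N)"] by (auto simp: g_def)
    then show "y \<in> emb ` {A. norm (emb A) \<le> R}"
      using bound[of "j * N"] by (metis g_def imageI j mem_Collect_eq)
  qed
  then have "finite (range g)"
    using finite_emb_bounded finite_imageI finite_subset by blast
  then have "\<not> inj g"
    using finite_imageD infinite_UNIV_nat by blast
  then obtain i j where ij: "i < j" "g i = g j"
    unfolding inj_on_def by (metis linorder_neqE_nat)
  have le: "f (i * N) x \<le> f (j * N) x" if "x \<in> X" for x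
    unfolding f_def using ij(1) u0[OF that]
    by (intro nat_mono floor_mono mult_right_mono) (simp_all add: mult_right_mono)
  have "f (i * N) z < f (j * N) z"
  proof -
    have "real (i * N) * u z + 1 \<le> real (Suc i * N) * u z"
      using N by (simp add: algebra_simps)
    also have "\<dots> \<le> real (j * N) * u z"
      using ij(1) z(2) by (intro mult_right_mono) (simp_all del: mult_Suc of_nat_mult add: Suc_leI)
    finally have "\<lfloor>real (i * N) * u z\<rfloor> + 1 \<le> \<lfloor>real (j * N) * u z\<rfloor>"
      by linarith
    moreover have "0 \<le> \<lfloor>real (i * N) * u z\<rfloor>"
      using z(2) by simp
    ultimately show ?thesis
      unfolding f_def by linarith
  qed
  \<comment> \<open>The natural subtraction never truncates on \<open>X\<close>, since the floors
    are monotone in the multiplier.\<close>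
  define k where "k x = f (j * N) x - f (i * N) x" for x
  obtain v where v: "v \<in> lists X" "emb (sum_list v) = (\<Sum>x\<in>X. real (k x) *\<^sub>R emb x)"
    "length v = (\<Sum>x\<in>X. k x)"
    using exists_word_with_multiplicities[OF fin] by blast
  have "(\<Sum>x\<in>X. real (k x) *\<^sub>R emb x) = g j - g i"
    using le by (simp add: k_def g_def of_nat_diff scaleR_diff_left sum_subtractf)
  then have "emb (sum_list v) = emb 0"
    using v(2) ij(2) by simp
  then have "sum_list v = 0"
    using inj_emb by (rule injD[rotated])
  moreover have "k z > 0"
    using \<open>f (i * N) z < f (j * N) z\<close> by (simp add: k_def)
  then have "v \<noteq> []"
    using v(3) fin z(1) by auto
  ultimately show ?thesis
    using v(1) by blast
qed

section \<open>Concatenation, powers and loops of admissible words\<close>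

lemma constrained_words_append:
  assumes "u \<in> constrained_words X C" and "v \<in> lists X"
    and "\<And>m. m \<le> length v \<Longrightarrow> sum_list u + sum_list (take m v) \<in> C"
  shows "u @ v \<in> constrained_words X C"
proof -
  have "sum_list (take m (u @ v)) \<in> C" if m: "m \<le> length (u @ v)" for m
  proof (cases "m \<le> length u")
    case True
    then show ?thesis
      using assms(1) by (simp add: constrained_words_def)
  next
    case False
    then show ?thesis
      using assms(3)[of "m - length u"] m by simp
  qed
  then show ?thesis
    using assms(1,2) by (simp add: constrained_words_def)
qed

text \<open>Past the first copy of \<open>w\<close>, a prefix sum is \<open>sum_list w\<close> plus
  a prefix sum of a shorter power, and \<open>C\<close> is closed under addition.\<close>

lemma concat_replicate_in_constrained_words:
  assumes "is_submonoid C" and "w \<in> constrained_words X C"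
  shows "concat (replicate n w) \<in> constrained_words X C"
proof (induction n)
  case 0
  show ?case
    using assms(1) by (simp add: constrained_words_def is_submonoid_def zero_prod_def)
next
  case (Suc n)
  have "w @ concat (replicate n w) \<in> constrained_words X C"
  proof (rule constrained_words_append[OF assms(2)])
    show "concat (replicate n w) \<in> lists X"
      using Suc by (simp add: constrained_words_def)
    fix m assume "m \<le> length (concat (replicate n w))"
    then have "sum_list (take m (concat (replicate n w))) \<in> C"
      using Suc by (simp add: constrained_words_def)
    moreover have "sum_list (take (length w) w) \<in> C"
      using assms(2) unfolding constrained_words_def by blast
    ultimately show "sum_list w + sum_list (take m (concat (replicate n w))) \<in> C"
      using assms(1) by (simp add: is_submonoid_def)
  qed
  then show ?case by simp
qed

text \<open>Each loop returns to the endpoint of \<open>u\<close>, so checking a single traversal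
  from there suffices for all of them.\<close>

lemma zero_sum_loops_in_constrained_words:
  assumes "u \<in> constrained_words X C" and "v \<in> lists X" and "sum_list v = 0"
    and "\<And>m. m \<le> length v \<Longrightarrow> sum_list u + sum_list (take m v) \<in> C"
  shows "u @ concat (replicate k v) \<in> constrained_words X C"
proof (induction k)
  case 0
  show ?case using assms(1) by simp
next
  case (Suc k)
  have "(u @ concat (replicate k v)) @ v \<in> constrained_words X C"
    using assms sum_list_concat_replicate_zero[OF assms(3), of k]
    by (intro constrained_words_append[OF Suc]) simp_all
  \<comment> \<open>The new loop is added on the right, whereas \<open>replicate\<close> unfolds on
    the left.\<close>
  moreover have "concat (replicate k v) @ v = concat (replicate (Suc k) v)"
    by (induction k) simp_all
  ultimately show ?case by simp
qed

section \<open>Translates of large multiples stay in the cone\<close>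

lemma eventually_in_half_plane:
  assumes "p \<in> open_half_plane a 0"
  shows "\<forall>\<^sub>F n in sequentially. real n *\<^sub>R p + q \<in> open_half_plane a 0"
proof -
  have pos: "a \<bullet> p > 0"
    using assms by (simp add: open_half_plane_def)
  obtain N :: nat where N: "- (a \<bullet> q) < real N * (a \<bullet> p)"
    using reals_Archimedean3[OF pos] by blast
  have "real n *\<^sub>R p + q \<in> open_half_plane a 0" if "n \<ge> N" for n
  proof -
    have "real N * (a \<bullet> p) \<le> real n * (a \<bullet> p)"
      using that pos by (intro mult_right_mono) simp_all
    then show ?thesis
      using N by (simp add: open_half_plane_def inner_add_right)
  qed
  then show ?thesis
    by (auto simp: eventually_sequentially)
qed

text \<open>The vertex lies on both bounding lines, which forces \<open>c = d = 0\<close>; each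
  half-plane then absorbs the shift by \<open>q\<close> for large \<open>n\<close>.\<close>

lemma eventually_in_cone:
  assumes "cone_with_vertex K (0, 0)" and "p \<in> K"
  shows "\<forall>\<^sub>F n in sequentially. real n *\<^sub>R p + q \<in> K"
proof -
  obtain a c b d where K: "K = open_half_plane a c \<inter> open_half_plane b d"
    and "bounding_line a c \<inter> bounding_line b d = {(0, 0)}"
    using assms(1) by (auto simp: cone_with_vertex_def)
  then have "(0, 0) \<in> bounding_line a c" "(0, 0) \<in> bounding_line b d"
    by blast+
  then have "c = 0" "d = 0"
    by (simp_all add: bounding_line_def flip: zero_prod_def)
  then show ?thesis
    using assms(2) K by (simp add: eventually_conj eventually_in_half_plane)
qed

section \<open>The implications between the three conditions\<close>

lemma FPP_iff: "FPP X C \<longleftrightarrow> (\<forall>A\<in>reachable X C. finite (words_to X C A))"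
  by (simp add: FPP_def num_paths_def)

lemma FPP_imp_zero_notin_convex_hull:
  assumes "finite X" and "is_submonoid C" and "cone_with_vertex K (0, 0)"
    and "K \<inter> range emb \<subseteq> emb ` C" and "K \<inter> emb ` reachable X C \<noteq> {}"
    and "FPP X C"
  shows "(0, 0) \<notin> convex hull (emb ` X)"
proof
  assume "(0, 0) \<in> convex hull (emb ` X)"
  then obtain v where v: "v \<in> lists X" "v \<noteq> []" "sum_list v = 0"
    using exists_zero_sum_word[OF assms(1)] by (auto simp: zero_prod_def)
  obtain w where w: "w \<in> constrained_words X C" "emb (sum_list w) \<in> K"
    using assms(5) by (auto simp: reachable_def)
  \<comment> \<open>The loop has finitely many prefixes, so one \<open>n\<close> serves all of
    them.\<close>
  have "\<forall>\<^sub>F n in sequentially. \<forall>m\<in>{..length v}.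
      real n *\<^sub>R emb (sum_list w) + emb (sum_list (take m v)) \<in> K"
    using eventually_in_cone[OF assms(3) w(2)] by (intro eventually_ball_finite) simp_all
  then obtain n where n: "\<And>m. m \<le> length v \<Longrightarrow>
      real n *\<^sub>R emb (sum_list w) + emb (sum_list (take m v)) \<in> K"
    by (auto simp: eventually_sequentially)
  define u where "u = concat (replicate n w)"
  have uC: "sum_list u + sum_list (take m v) \<in> C" if "m \<le> length v" for m
  proof -
    have "emb (sum_list u + sum_list (take m v)) \<in> K"
      using n[OF that] by (simp add: emb_add u_def emb_sum_list_concat_replicate)
    then have "emb (sum_list u + sum_list (take m v)) \<in> emb ` C"
      using assms(4) by blast
    then show ?thesis
      using inj_emb by (simp add: inj_image_mem_iff)
  qed
  have u: "u \<in> constrained_words X C"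
    unfolding u_def by (rule concat_replicate_in_constrained_words[OF assms(2) w(1)])
  let ?p = "\<lambda>k. u @ concat (replicate k v)"
  have "range ?p \<subseteq> words_to X C (sum_list u)"
    using zero_sum_loops_in_constrained_words[OF u v(1,3) uC] sum_list_concat_replicate_zero[OF v(3)]
    by (auto simp: words_to_def)
  moreover have "finite (words_to X C (sum_list u))"
    using assms(6) u by (auto simp: FPP_iff reachable_def)
  moreover have "inj ?p"
  proof (rule injI)
    fix i j assume "?p i = ?p j"
    then have "length (concat (replicate i v)) = length (concat (replicate j v))"
      by simp
    then show "i = j"
      using v(2) by (simp add: length_concat sum_list_replicate)
  qed
  ultimately show False
    using finite_subset range_inj_infinite by blast
qed

text \<open>The hull of a finite set is compact, so a hyperplane strictly separates it from the
  origin, and its parallel through the origin gives the line. Conversely, a convex half-plane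
  containing the steps contains their hull.\<close>

lemma zero_notin_convex_hull_iff_LC:
  assumes "finite X"
  shows "(0, 0) \<notin> convex hull (emb ` X) \<longleftrightarrow> LC X"
proof
  assume "(0, 0) \<notin> convex hull (emb ` X)"
  moreover have "closed (convex hull (emb ` X))"
    using assms by (simp add: compact_imp_closed finite_imp_compact_convex_hull)
  ultimately obtain a b where ab: "a \<noteq> 0" "0 < b" "\<forall>x\<in>convex hull (emb ` X). b < a \<bullet> x"
    using separating_hyperplane_closed_0[of "convex hull (emb ` X)"]
    by (auto simp: zero_prod_def)
  have "emb ` X \<subseteq> open_half_plane a 0"
    using ab hull_inc[of _ "emb ` X" convex] unfolding open_half_plane_def
    by (smt (verit) mem_Collect_eq subsetI)
  then show "LC X"
    unfolding LC_def using ab(1)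
    by (intro exI[of _ a] exI[of _ 0]) (simp add: bounding_line_def flip: zero_prod_def)
next
  assume "LC X"
  then obtain a where "emb ` X \<subseteq> open_half_plane a 0"
    by (auto simp: LC_def bounding_line_def simp flip: zero_prod_def)
  moreover have "convex (open_half_plane a 0)"
    unfolding open_half_plane_def by (rule convex_halfspace_gt)
  ultimately have "convex hull (emb ` X) \<subseteq> open_half_plane a 0"
    by (rule hull_minimal)
  then show "(0, 0) \<notin> convex hull (emb ` X)"
    by (auto simp: open_half_plane_def simp flip: zero_prod_def)
qed

text \<open>Every step increases the functional given by \<open>a\<close> by at least some fixed
  \<delta> > 0. The endpoint therefore bounds the length of a word, and finitely many letters form
  only finitely many words of bounded length.\<close>

lemma LC_imp_FPP:
  assumes "finite X" and "LC X"
  shows "FPP X C"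
  unfolding FPP_iff
proof
  fix A
  obtain a where a: "emb ` X \<subseteq> open_half_plane a 0"
    using assms(2) by (auto simp: LC_def bounding_line_def simp flip: zero_prod_def)
  obtain \<delta> where \<delta>: "\<delta> > 0" "\<And>x. x \<in> X \<Longrightarrow> \<delta> \<le> a \<bullet> emb x"
  \<comment> \<open>\<delta> is the minimum of the functional over the steps. The empty set has no
    minimum, and there any positive value works.\<close>
  proof (cases "X = {}")
    case True
    then show ?thesis using that[of 1] by simp
  next
    case False
    show ?thesis
    proof (rule that)
      show "0 < Min ((\<lambda>x. a \<bullet> emb x) ` X)"
        using a False assms(1) by (auto simp: open_half_plane_def)
      show "Min ((\<lambda>x. a \<bullet> emb x) ` X) \<le> a \<bullet> emb x" if "x \<in> X" for x
        using that assms(1) by simp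
    qed
  qed
  have len: "real (length w) * \<delta> \<le> a \<bullet> emb (sum_list w)" if "w \<in> lists X" for w
    using that
  proof (induction w)
    case (Cons x w)
    then show ?case
      using \<delta>(2)[of x] by (simp add: emb_add inner_add_right algebra_simps)
  qed simp
  have "words_to X C A \<subseteq> {w. set w \<subseteq> X \<and> length w \<le> nat \<lfloor>a \<bullet> emb A / \<delta>\<rfloor>}"
  proof
    fix w assume "w \<in> words_to X C A"
    then have w: "w \<in> lists X" "sum_list w = A"
      by (simp_all add: words_to_def constrained_words_def)
    then have "real (length w) \<le> a \<bullet> emb A / \<delta>"
      using len[OF w(1)] \<delta>(1) by (simp add: field_simps)
    then show "w \<in> {w. set w \<subseteq> X \<and> length w \<le> nat \<lfloor>a \<bullet> emb A / \<delta>\<rfloor>}"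
      using w(1) by (auto simp: le_nat_floor)
  qed
  then show "finite (words_to X C A)"
    using finite_lists_length_le[OF assms(1)] finite_subset by blast
qed

theorem theorem3p18:
  fixes X C :: "(int \<times> int) set" and K :: "(real \<times> real) set"
  assumes "step_set X" and "finite X"
    and "is_submonoid C"
    and "cone_with_vertex K (0, 0)"
    and "K \<inter> range emb \<subseteq> emb ` C"
    and "K \<inter> emb ` reachable X C \<noteq> {}"
  shows "(FPP X C \<longleftrightarrow> (0, 0) \<notin> convex hull (emb ` X)) \<and>
         ((0, 0) \<notin> convex hull (emb ` X) \<longleftrightarrow> LC X)"
  using FPP_imp_zero_notin_convex_hull[OF assms(2-6)] zero_notin_convex_hull_iff_LC[OF assms(2)]
    LC_imp_FPP[OF assms(2)] by blast

end
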